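(* Let $d\ge 3$ and let $\mu_1,\mu_2$ be $d$-dimensional probability measures on $\mathbb{R}^d$ with zero mean and $2+\beta$ moments, for some $\beta>0$. If $X$ is a random walk generated by $\mu_1,\mu_2$ and an arbitrary adapted rule $\ell$, then $X$ is transient.
   Context: Conventions. $\|\cdot\|$ is the Euclidean norm on $\mathbb{R}^d$. A probability measure $\mu$ on $\mathbb{R}^d$ has mean $0$ (zero mean) if $\int_{\mathbb{R}^d} x\,\mu(dx)=0$, and has $\gamma$ moments if $\mathbb{E}[\|Z\|^{\gamma}]<\infty$ for $Z\sim\mu$. Its covariance matrix is $\mathrm{Cov}(\mu)=(\mathbb{E}[Z_iZ_j])_{i,j=1}^d$, $Z\sim\mu$. The measure $\mu$ is called $d$-dimensional if its covariance matrix is invertible (equivalently, its support contains $d$ linearly independent vectors). Walk generated by measures and an adapted rule. Let $\mu_1,\ldots,\mu_k$ be probability measures on $\mathbb{R}^d$ and for each $j=1,\ldots,k$ let $\xi^j_1,\xi^j_2,\ldots$ be i.i.d. with law $\mu_j$. An adapted rule $\ell=(\ell(i))_{i\ge 0}$ with respect to a filtration $(\mathcal{F}_i)_{i\ge 0}$ is a process with $\ell(i)\in\{1,\ldots,k\}$ and $\ell(i)$ $\mathcal{F}_i$-measurable for all $i$. Here the filtration represents the history of the process: $\xi^j_i$ is $\mathcal{F}_i$-measurable for all $i\ge1$ and all $j$, and $(\xi^1_{i+1},\ldots,\xi^k_{i+1})$ is independent of $\mathcal{F}_i$ for all $i\ge 0$. The walk $X$ generated by $\mu_1,\ldots,\mu_k$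 and the rule $\ell$ is defined by $X_0=0$ and $X_{i+1}=X_i+\xi^{\ell(i)}_{i+1}$. Transient means that almost surely $\|X_t\|\to\infty$ as $t\to\infty$. *)

theory Defs
  imports "HOL-Probability.Probability"
begin

definition borel_prob_measure :: "(real ^ 'd) measure \<Rightarrow> bool" where
  "borel_prob_measure \<mu> \<longleftrightarrow> prob_space \<mu> \<and> sets \<mu> = sets borel"

(* The Bochner integral of a non-integrable function is 0, so integrability is
   required explicitly. *)
definition zero_mean :: "(real ^ 'd) measure \<Rightarrow> bool" where
  "zero_mean \<mu> \<longleftrightarrow> integrable \<mu> (\<lambda>x. x) \<and> (\<integral>x. x \<partial>\<mu>) = 0"

definition has_moments :: "(real ^ 'd) measure \<Rightarrow> real \<Rightarrow> bool" where
  "has_moments \<mu> \<gamma> \<longleftrightarrow> integrable \<mu> (\<lambda>x. norm x powr \<gamma>)"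

(* Meaningful for measures with second moments only; no centering, as it is used
   for zero-mean measures. *)
definition cov_matrix :: "(real ^ 'd) measure \<Rightarrow> real ^ 'd ^ 'd" where
  "cov_matrix \<mu> = (\<chi> i j. \<integral>z. z $ i * z $ j \<partial>\<mu>)"

definition full_dimensional :: "(real ^ 'd) measure \<Rightarrow> bool" where
  "full_dimensional \<mu> \<longleftrightarrow> invertible (cov_matrix \<mu>)"

(* \<xi> j i is the i-th increment of the j-th kind, where 1 \<le> j \<le> k and i \<ge> 1; the values
   \<xi> j 0 are unconstrained and unused. For fixed i the increments \<xi> 1 i, ..., \<xi> k i may
   depend on each other: only their joint vector is independent of the past. *)
locale generated_walk =
  prob_space M + filtration "space M" F
  for M :: "'a measure"
  and F :: "nat \<Rightarrow> 'a measure" +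
  fixes k :: nat
    and \<mu> :: "nat \<Rightarrow> (real ^ 'd) measure"
    and \<xi> :: "nat \<Rightarrow> nat \<Rightarrow> 'a \<Rightarrow> real ^ 'd"
    and l :: "nat \<Rightarrow> 'a \<Rightarrow> nat"
    and X :: "nat \<Rightarrow> 'a \<Rightarrow> real ^ 'd"
  assumes F_subalgebra: "\<And>i. subalgebra M (F i)"
    and prob_\<mu>: "\<And>j. j \<in> {1..k} \<Longrightarrow> borel_prob_measure (\<mu> j)"
    and \<xi>_indep: "\<And>j. j \<in> {1..k} \<Longrightarrow> indep_vars (\<lambda>_. borel) (\<xi> j) {1..}"
    and \<xi>_law: "\<And>i j. j \<in> {1..k} \<Longrightarrow> i \<ge> 1 \<Longrightarrow> distr M borel (\<xi> j i) = \<mu> j"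
    and \<xi>_adapted: "\<And>i j. j \<in> {1..k} \<Longrightarrow> i \<ge> 1 \<Longrightarrow> \<xi> j i \<in> borel_measurable (F i)"
    and \<xi>_indep_past: "\<And>i. indep_set (sets (F i))
          (sets (vimage_algebra (space M) (\<lambda>\<omega>. \<lambda>j\<in>{1..k}. \<xi> j (i + 1) \<omega>)
                   (Pi\<^sub>M {1..k} (\<lambda>_. borel))))"
    and rule_adapted: "\<And>i. l i \<in> measurable (F i) (count_space {1..k})"
    and X_0: "\<And>\<omega>. \<omega> \<in> space M \<Longrightarrow> X 0 \<omega> = 0"
    and X_step: "\<And>i \<omega>. \<omega> \<in> space M \<Longrightarrow> X (i + 1) \<omega> = X i \<omega> + \<xi> (l i \<omega>) (i + 1) \<omega>"

definition transient :: "'a measure \<Rightarrow> (nat \<Rightarrow> 'a \<Rightarrow> real ^ 'd) \<Rightarrow> bool" where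
  "transient M X \<longleftrightarrow> (AE \<omega> in M. filterlim (\<lambda>t. norm (X t \<omega>)) at_top sequentially)"

end

(* Let A and B be the two covariance forms. Maximising B/A successively on A-orthogonal complements
   diagonalises both on a 3-dimensional quotient; a suitable scaling of the three coordinates then
   makes, for each measure, the trace of the projected covariance exceed twice its largest
   eigenvalue. Project the walk by this linear map L to R^3. Under the trace condition the function
   phi(y) = (K + |y|^2)^(-alpha), for small alpha and large K, satisfies
     E phi(y + L xi) + c (K + |y|^2)^(-alpha - 1) <= phi(y)
   for every y and both laws: because of the shift K there is no exceptional ball. Summing this
   inequality along the walk bounds the expected sum of (K + |L X_t|^2)^(-alpha - 1). The sum is
   therefore almost surely finite, so its terms tend to 0 and |L X_t| tends to infinity. *)
theory Submission
  imports Defs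
begin

section \<open>Simultaneous diagonalisation\<close>

definition pos_def_form :: "('e::real_vector \<Rightarrow> 'e \<Rightarrow> real) \<Rightarrow> bool" where
  "pos_def_form B \<longleftrightarrow> bilinear B \<and> (\<forall>v w. B v w = B w v) \<and> (\<forall>v. v \<noteq> 0 \<longrightarrow> B v v > 0)"

lemma continuous_on_bilinear_diag:
  fixes B :: "'e::euclidean_space \<Rightarrow> 'e \<Rightarrow> real"
  assumes "bilinear B"
  shows "continuous_on S (\<lambda>v. B v v)"
proof -
  interpret bounded_bilinear B using assms by (simp add: bilinear_conv_bounded_bilinear)
  show ?thesis by (intro continuous_on continuous_on_id)
qed

text \<open>The ratio of B to A on the diagonal is invariant under scaling, so its maximum over
  \<open>S\<close> is attained on the compact unit sphere of \<open>S\<close>; the maximiser is then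
  normalised by A. The last conclusion is the critical-point equation: inside \<open>S\<close>, the
  A-orthogonal complement of the maximiser is also B-orthogonal to it. This lets the diagonalisation
  proceed by restriction to smaller and smaller subspaces.\<close>

lemma max_ratio_vector:
  fixes A B :: "'e::euclidean_space \<Rightarrow> 'e \<Rightarrow> real"
  assumes A: "pos_def_form A" and B: "pos_def_form B"
    and S: "subspace S" "S \<noteq> {0}"
  obtains u where "u \<in> S" "A u u = 1" "\<And>w. w \<in> S \<Longrightarrow> B w w \<le> B u u * A w w"
    "\<And>w. w \<in> S \<Longrightarrow> A u w = 0 \<Longrightarrow> B u w = 0"
proof -
  have bil: "bilinear A" "bilinear B" and sym: "A v w = A w v" "B v w = B w v"
    and Apos: "v \<noteq> 0 \<Longrightarrow> A v v > 0" for v w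
    using A B by (auto simp: pos_def_form_def)
  note bl = bilinear_ladd[OF bil(1)] bilinear_radd[OF bil(1)] bilinear_lmul[OF bil(1)] bilinear_rmul[OF bil(1)]
    bilinear_ladd[OF bil(2)] bilinear_radd[OF bil(2)] bilinear_lmul[OF bil(2)] bilinear_rmul[OF bil(2)]
  obtain x where x: "x \<in> S" "x \<noteq> 0" using S subspace_0 by blast
  let ?K = "sphere 0 1 \<inter> S"
  have "compact ?K" using S(1) closed_subspace by (intro compact_Int_closed) auto
  moreover have "x /\<^sub>R norm x \<in> ?K" using x S(1) by (auto intro: subspace_scale)
  moreover have "continuous_on ?K (\<lambda>v. B v v / A v v)"
  proof (intro continuous_on_divide continuous_on_bilinear_diag[OF bil(1)] continuous_on_bilinear_diag[OF bil(2)] ballI)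
    fix v assume "v \<in> ?K"
    hence "v \<noteq> 0" by auto
    thus "A v v \<noteq> 0" using Apos[of v] by simp
  qed
  ultimately obtain v where v: "v \<in> ?K" "\<And>w. w \<in> ?K \<Longrightarrow> B w w / A w w \<le> B v v / A v v"
    using continuous_attains_sup[of ?K "\<lambda>v. B v v / A v v"] by blast
  have v0: "v \<noteq> 0" "v \<in> S" using v(1) by auto
  define u where "u = v /\<^sub>R sqrt (A v v)"
  define a where "a = B u u"
  have uS: "u \<in> S" using v0 S(1) by (simp add: u_def subspace_scale)
  have Au: "A u u = 1" and a: "a = B v v / A v v"
    using Apos[OF v0(1)] by (auto simp: u_def a_def bl field_simps)
  have max: "B w w \<le> a * A w w" if "w \<in> S" for w
  proof (cases "w = 0")
    case True
    thus ?thesis using bilinear_lzero[OF bil(1)] bilinear_lzero[OF bil(2)] by simp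
  next
    case False
    have "w /\<^sub>R norm w \<in> ?K" using that False S(1) by (auto intro: subspace_scale)
    from v(2)[OF this] have "B w w / A w w \<le> a" using False by (simp add: bl a)
    thus ?thesis using Apos[OF False] by (simp add: field_simps)
  qed
  \<comment> \<open>First-order condition: B grows linearly along u + t w unless B u w = 0, but A only quadratically.\<close>
  have "B u w = 0" if w: "w \<in> S" "A u w = 0" for w
  proof (rule ccontr)
    assume nz: "B u w \<noteq> 0"
    define c where "c = a * A w w - B w w"
    have c: "c \<ge> 0" using max[OF w(1)] by (simp add: c_def)
    have ineq: "2 * t * B u w \<le> t\<^sup>2 * c" for t
    proof -
      have "u + t *\<^sub>R w \<in> S" using uS w S(1) by (intro subspace_add subspace_scale)
      from max[OF this] show ?thesis
        using w sym[of w u] Au by (simp add: bl c_def a_def power2_eq_square algebra_simps)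
    qed
    \<comment> \<open>With this t the linear term \<open>2 * t * B u w\<close> equals
      \<open>2 * t\<^sup>2 * (c + 1)\<close>, which exceeds the quadratic bound
      \<open>t\<^sup>2 * c\<close>.\<close>
    define t where "t = B u w / (c + 1)"
    have "t * (c + 1) = B u w" using c by (simp add: t_def)
    have "2 * t * (t * (c + 1)) \<le> t\<^sup>2 * c" using ineq[of t] \<open>t * (c + 1) = B u w\<close> by simp
    hence "t\<^sup>2 * (c + 2) \<le> 0" by (simp add: power2_eq_square algebra_simps)
    moreover have "t\<^sup>2 * (c + 2) > 0" using nz c by (auto simp: t_def intro!: mult_pos_pos)
    ultimately show False by simp
  qed
  with that uS Au max show thesis by (auto simp: a_def)
qed

lemma kernel_nontrivial:
  fixes f :: "'e::euclidean_space \<Rightarrow> 'f::euclidean_space"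
  assumes "linear f" "DIM('f) < DIM('e)"
  obtains x where "x \<noteq> 0" "f x = 0"
proof -
  have "\<not> inj f"
  proof
    assume "inj f"
    hence "dim (range f) = DIM('e)" using dim_image_eq[OF assms(1), of UNIV] by (simp add: dim_UNIV)
    thus False using dim_subset_UNIV[of "range f"] assms(2) by simp
  qed
  thus thesis using that linear_injective_0[OF assms(1)] by blast
qed

text \<open>The \<open>v i\<close> become the rows of one projection to R^3 that serves both laws.
  Orthogonality makes both projected covariances diagonal, so \<kappa> and \<rho> bound their
  eigenvalues and the sums are their traces. If three positive diagonal entries have their maximum
  attained twice, the trace exceeds twice the maximum by the third entry; one scaling of a common
  diagonalising basis achieves this for both forms at once.\<close>

lemma simultaneous_trace_condition:
  fixes A B :: "'e::euclidean_space \<Rightarrow> 'e \<Rightarrow> real"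
  assumes A: "pos_def_form A" and B: "pos_def_form B" and dim: "DIM('e) \<ge> 3"
  obtains v :: "3 \<Rightarrow> 'e" and \<kappa> \<rho> where
    "\<And>i j. i \<noteq> j \<Longrightarrow> A (v i) (v j) = 0" "\<And>i. A (v i) (v i) \<le> \<kappa>" "2 * \<kappa> < (\<Sum>i\<in>UNIV. A (v i) (v i))"
    "\<And>i j. i \<noteq> j \<Longrightarrow> B (v i) (v j) = 0" "\<And>i. B (v i) (v i) \<le> \<rho>" "2 * \<rho> < (\<Sum>i\<in>UNIV. B (v i) (v i))"
proof -
  have bil: "bilinear A" "bilinear B" and sym: "A v w = A w v" "B v w = B w v"
    and Bpos: "v \<noteq> 0 \<Longrightarrow> B v v > 0" for v w
    using A B by (auto simp: pos_def_form_def)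
  have lin: "linear (A v)" "linear (B v)" for v using bil by (auto simp: bilinear_def)
  note bl = bilinear_lmul[OF bil(1)] bilinear_rmul[OF bil(1)] bilinear_lmul[OF bil(2)] bilinear_rmul[OF bil(2)]
    bilinear_lzero[OF bil(1)]
  have U: "(UNIV :: 'e set) \<noteq> {0}"
  proof -
    obtain x :: 'e where "x \<in> Basis" using nonempty_Basis by blast
    thus ?thesis using nonzero_Basis by blast
  qed
  obtain u1 where u1: "A u1 u1 = 1"
      "\<And>w. w \<in> UNIV \<Longrightarrow> B w w \<le> B u1 u1 * A w w" "\<And>w. w \<in> UNIV \<Longrightarrow> A u1 w = 0 \<Longrightarrow> B u1 w = 0"
    by (rule max_ratio_vector[OF A B subspace_UNIV U], rule that)
  define S2 where "S2 = {w. A u1 w = 0}"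
  have sS2: "subspace S2"
    unfolding S2_def by (rule linear_subspace_kernel[OF lin(1)])
  have nS2: "S2 \<noteq> {0}"
    using kernel_nontrivial[OF lin(1)[of u1]] dim by (auto simp: S2_def)
  obtain u2 where u2: "u2 \<in> S2" "A u2 u2 = 1"
      "\<And>w. w \<in> S2 \<Longrightarrow> B w w \<le> B u2 u2 * A w w" "\<And>w. w \<in> S2 \<Longrightarrow> A u2 w = 0 \<Longrightarrow> B u2 w = 0"
    by (rule max_ratio_vector[OF A B sS2 nS2], rule that)
  define S3 where "S3 = {w. A u1 w = 0 \<and> A u2 w = 0}"
  have l3: "linear (\<lambda>w. (A u1 w, A u2 w))" using lin by (intro linearI) (simp_all add: linear_add linear_scale)
  have "S3 = {w. (A u1 w, A u2 w) = 0}" by (auto simp: S3_def zero_prod_def)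
  hence sS3: "subspace S3" using linear_subspace_kernel[OF l3] by simp
  \<comment> \<open>This is where dimension at least 3 enters: two linear conditions still leave a
    nonzero vector.\<close>
  have nS3: "S3 \<noteq> {0}"
    using kernel_nontrivial[OF l3] dim by (auto simp: S3_def zero_prod_def)
  obtain u3 where u3: "u3 \<in> S3" "A u3 u3 = 1"
    by (rule max_ratio_vector[OF A B sS3 nS3], rule that)
  define a b c where "a = B u1 u1" and "b = B u2 u2" and "c = B u3 u3"
  have ne: "u1 \<noteq> 0" "u2 \<noteq> 0" "u3 \<noteq> 0" using u1(1) u2(2) u3(2) by (auto simp: bl)
  have pos: "a > 0" "b > 0" "c > 0" using Bpos ne by (auto simp: a_def b_def c_def)
  have oA: "A u1 u2 = 0" "A u1 u3 = 0" "A u2 u3 = 0" using u2(1) u3(1) by (simp_all add: S2_def S3_def)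
  hence S: "u2 \<in> S2" "u3 \<in> S2" by (simp_all add: S2_def)
  have oB: "B u1 u2 = 0" "B u1 u3 = 0" "B u2 u3 = 0"
    by (rule u1(3)[OF UNIV_I oA(1)] u1(3)[OF UNIV_I oA(2)] u2(4)[OF S(2) oA(3)])+
  \<comment> \<open>Each vector lies in the subspace over which the previous one maximises the
    ratio, so the successive maxima decrease.\<close>
  have ord: "b \<le> a" "c \<le> b"
    using u1(2)[of u2] u2(3)[OF S(2)] u2(2) u3(2) by (simp_all add: a_def b_def c_def)
  \<comment> \<open>With a \<ge> b \<ge> c, this scaling gives the diagonals (b/a, 1, 1) for A and (b, b, c) for B;
    the largest entry of each occurs twice.\<close>
  define v :: "3 \<Rightarrow> 'e" where "v i = (if i = 1 then sqrt (b / a) *\<^sub>R u1 else if i = 2 then u2 else u3)" for i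
  have v: "v 1 = sqrt (b / a) *\<^sub>R u1" "v 2 = u2" "v 3 = u3" by (auto simp: v_def)
  have vA: "A (v 1) (v 1) = b / a" "A (v 2) (v 2) = 1" "A (v 3) (v 3) = 1"
    using u1(1) u2(2) u3(2) pos by (simp_all add: v bl)
  have "sqrt (b / a) * (sqrt (b / a) * a) = (sqrt (b / a))\<^sup>2 * a" by (simp only: power2_eq_square mult.assoc)
  hence "sqrt (b / a) * (sqrt (b / a) * a) = b" using pos by simp
  hence vB: "B (v 1) (v 1) = b" "B (v 2) (v 2) = b" "B (v 3) (v 3) = c"
    using pos by (simp_all add: v bl a_def[symmetric] b_def[symmetric] c_def[symmetric])
  note sA = sym(1)[of u2 u1] sym(1)[of u3 u1] sym(1)[of u3 u2]
  note sB = sym(2)[of u2 u1] sym(2)[of u3 u1] sym(2)[of u3 u2]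
  have orth: "\<forall>i j. i \<noteq> j \<longrightarrow> A (v i) (v j) = 0 \<and> B (v i) (v j) = 0"
    by (simp add: forall_3 v bl oA oB sA sB)
  have diag: "\<forall>i. A (v i) (v i) \<le> 1 \<and> B (v i) (v i) \<le> b"
    using ord pos by (simp add: forall_3 vA vB)
  show thesis
  proof (rule that[of v 1 b])
    fix i j :: 3 assume "i \<noteq> j"
    thus "A (v i) (v j) = 0" "B (v i) (v j) = 0" using orth by auto
  next
    fix i :: 3
    show "A (v i) (v i) \<le> 1" "B (v i) (v i) \<le> b" using diag by auto
  qed (simp_all add: sum_3 vA vB pos)
qed

section \<open>The Lyapunov function\<close>

text \<open>Second-order Taylor expansion at 0 with Lagrange remainder. The range 9/16 keeps the
  intermediate point above -9/16, so the third derivative is bounded through the base 7/16. The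
  value 9/16 is 9/4 times 1/4, the range of u produced by relative increments of size at most 1/4 in
  the expansion of the Lyapunov function.\<close>

lemma powr_minus_taylor:
  fixes \<alpha> :: real
  assumes "\<alpha> > 0"
  obtains C where "C \<ge> 0" 
    "\<And>u. \<bar>u\<bar> \<le> 9/16 \<Longrightarrow>
      (1 + u) powr (-\<alpha>) \<le> 1 - \<alpha> * u + \<alpha> * (\<alpha> + 1) / 2 * u\<^sup>2 + C * \<bar>u\<bar> ^ 3"
proof
  define D where "D = \<alpha> * (\<alpha> + 1) * (\<alpha> + 2) / 6"
  define C where "C = D * (7/16) powr (-\<alpha> - 3)"
  have D: "D \<ge> 0" using assms by (simp add: D_def)
  show "C \<ge> 0" using D by (simp add: C_def)
  fix u :: real assume u: "\<bar>u\<bar> \<le> 9/16"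
  show "(1 + u) powr (-\<alpha>) \<le> 1 - \<alpha> * u + \<alpha> * (\<alpha> + 1) / 2 * u\<^sup>2 + C * \<bar>u\<bar> ^ 3"
  proof (cases "u = 0")
    case False
    \<comment> \<open>\<open>diff m\<close> is the m-th derivative of
      \<open>(1 + x) powr (-\<alpha>)\<close>, written with the falling product of
      exponents.\<close>
    define diff where "diff m x = (\<Prod>i<m. -\<alpha> - real i) * (1 + x) powr (-\<alpha> - real m)" for m x
    have deriv: "DERIV (diff m) t :> diff (Suc m) t" if "-9/16 \<le> t" for m t
      unfolding diff_def using that
      by (auto intro!: derivative_eq_intros simp: algebra_simps)
    obtain t where t: "if u < 0 then u < t \<and> t < 0 else 0 < t \<and> t < u"
      and eq: "(1 + u) powr (-\<alpha>) = (\<Sum>m<3. diff m 0 / fact m * (u - 0) ^ m) + diff 3 t / fact 3 * (u - 0) ^ 3"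
    proof -
      have "\<exists>t. (if u < 0 then u < t \<and> t < 0 else 0 < t \<and> t < u) \<and>
          (1 + u) powr (-\<alpha>) = (\<Sum>m<3. diff m 0 / fact m * (u - 0) ^ m) + diff 3 t / fact 3 * (u - 0) ^ 3"
        using u False deriv by (intro Taylor[of 3 diff _ "-9/16" "9/16" 0 u]) (auto simp: diff_def)
      thus ?thesis using that by blast
    qed
    have "-9/16 \<le> t" using t u by (auto split: if_splits)
    hence t': "(1 + t) powr (-\<alpha> - 3) \<le> (7/16) powr (-\<alpha> - 3)"
      using assms by (intro powr_mono2') auto
    have "diff 3 t / fact 3 * u ^ 3 = D * ((1 + t) powr (-\<alpha> - 3) * (- (u ^ 3)))"
      by (simp add: diff_def D_def eval_nat_numeral algebra_simps)
    also have "\<dots> \<le> D * ((1 + t) powr (-\<alpha> - 3) * \<bar>u\<bar> ^ 3)"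
      using D by (intro mult_left_mono) (auto simp: power_abs[symmetric])
    also have "\<dots> \<le> D * ((7/16) powr (-\<alpha> - 3) * \<bar>u\<bar> ^ 3)"
      using D t' by (intro mult_left_mono mult_right_mono) auto
    finally have "diff 3 t / fact 3 * u ^ 3 \<le> C * \<bar>u\<bar> ^ 3"
      by (simp add: C_def)
    moreover have "(\<Sum>m<3. diff m 0 / fact m * u ^ m) = 1 - \<alpha> * u + \<alpha> * (\<alpha> + 1) / 2 * u\<^sup>2"
      by (simp add: diff_def eval_nat_numeral algebra_simps add_divide_distrib)
    ultimately show ?thesis using eq by simp
  qed simp
qed

lemma lyapunov_taylor:
  fixes \<alpha> p :: real
  assumes \<alpha>: "\<alpha> > 0" and p: "2 \<le> p" "p \<le> 3"
  obtains C where "C \<ge> 0"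
    "\<And>K (y::'b::real_inner) h. K \<ge> 1 \<Longrightarrow> 
       (K + (norm (y + h))\<^sup>2) powr (-\<alpha>) \<le>
         (K + (norm y)\<^sup>2) powr (-\<alpha>) *
           (1 - \<alpha> * (2 * (y \<bullet> h) + (norm h)\<^sup>2) / (K + (norm y)\<^sup>2)
              + 2 * \<alpha> * (\<alpha> + 1) * (y \<bullet> h)\<^sup>2 / (K + (norm y)\<^sup>2)\<^sup>2)
         + C * norm h powr p * (K + (norm y)\<^sup>2) powr (- p / 2)"
proof -
  obtain C where C: "C \<ge> 0" "\<And>u. \<bar>u\<bar> \<le> 9/16 \<Longrightarrow>
      (1 + u) powr (-\<alpha>) \<le> 1 - \<alpha> * u + \<alpha> * (\<alpha> + 1) / 2 * u\<^sup>2 + C * \<bar>u\<bar> ^ 3"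
    using powr_minus_taylor[OF \<alpha>] by blast
  \<comment> \<open>The first two summands pay for large increments; the other two pay for the
    excess of \<open>u\<^sup>2\<close> over \<open>4 * a\<^sup>2\<close> and for the cubic remainder
    at small increments.\<close>
  define D where "D = 64 + 36 * \<alpha> + 5 * (\<alpha> * (\<alpha> + 1) / 2) + (9/4)^3 * C"
  have D0: "D \<ge> 0" using \<alpha> C(1) by (simp add: D_def)
  show thesis
  proof (rule that)
    show "D \<ge> 0" by fact
    fix K :: real and y h :: 'b
    assume K: "K \<ge> 1"
    \<comment> \<open>In these relative variables the shifted square norm after the increment is
      \<open>s * (1 + u)\<close>, and Cauchy-Schwarz bounds the absolute value of a by r.\<close>
    define s where "s = K + (norm y)\<^sup>2"
    define r where "r = norm h / sqrt s"
    define a where "a = (y \<bullet> h) / s"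
    define u where "u = 2 * a + r\<^sup>2"
    define Q where "Q = 1 - \<alpha> * u + 2 * \<alpha> * (\<alpha> + 1) * a\<^sup>2"
    have s1: "s \<ge> 1" using K by (simp add: s_def add_increasing2)
    hence s: "s \<ge> 1" "s > 0" by auto
    have r0: "r \<ge> 0" using s by (simp add: r_def)
    have "norm y \<le> sqrt s"
      using K by (intro real_le_rsqrt) (simp add: s_def)
    have "\<bar>y \<bullet> h\<bar> \<le> norm y * norm h" by (rule Cauchy_Schwarz_ineq2)
    also have "\<dots> \<le> sqrt s * norm h" using \<open>norm y \<le> sqrt s\<close> by (rule mult_right_mono) simp
    also have "\<dots> = r * s"
      using s by (simp add: r_def real_div_sqrt field_simps)
    finally have ar: "\<bar>a\<bar> \<le> r" using s by (simp add: a_def field_simps)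
    have r2: "r\<^sup>2 = (norm h)\<^sup>2 / s" using s by (simp add: r_def power_divide)
    have seq: "K + (norm (y + h))\<^sup>2 = s * (1 + u)"
    proof -
      have "s * (1 + u) = s + 2 * (y \<bullet> h) + (norm h)\<^sup>2"
        using s by (simp add: u_def r2 a_def field_simps)
      thus ?thesis
        by (simp add: s_def power2_norm_eq_inner inner_add inner_commute)
    qed
    have "K + (norm (y + h))\<^sup>2 \<ge> 1" using K by (simp add: add_increasing2)
    hence u1: "1 + u > 0" "s * (1 + u) \<ge> 1"
      using s seq by (auto simp: zero_less_mult_iff dest: less_le_trans[OF zero_less_one])
    have rp: "norm h powr p * s powr (- p / 2) = r powr p"
    proof -
      have "sqrt s powr p = s powr (p/2)" using s by (simp add: powr_half_sqrt[symmetric] powr_powr)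
      thus ?thesis using s by (simp add: r_def powr_divide powr_minus_divide)
    qed
    have sa: "0 \<le> s powr (-\<alpha>)" "s powr (-\<alpha>) \<le> 1"
      using powr_mono[of "-\<alpha>" 0 s] s \<alpha> by simp_all
    have main: "(s * (1 + u)) powr (-\<alpha>) \<le> s powr (-\<alpha>) * Q + D * r powr p"
    proof (cases "r \<le> 1/4")
      case True
      have r3: "r ^ 3 \<le> r powr p"
      proof (cases "r = 0")
        case False
        hence "r ^ 3 = r powr 3" using r0 by (simp add: powr_numeral)
        also have "\<dots> \<le> r powr p" using True r0 p by (intro powr_mono') auto
        finally show ?thesis .
      qed simp
      have rr: "r\<^sup>2 \<le> r / 4" "r ^ 4 \<le> r ^ 3" 
        using mult_left_mono[OF True r0] mult_left_mono[of r 1 "r^3"] r0 True by (auto simp: power2_eq_square eval_nat_numeral)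
      have ur: "\<bar>u\<bar> \<le> 9/4 * r" using ar rr r0 zero_le_power2[of r] unfolding u_def abs_le_iff by linarith
      hence "\<bar>u\<bar> \<le> 9/16" using True by simp
      hence "(1 + u) powr (-\<alpha>) \<le> 1 - \<alpha> * u + \<alpha> * (\<alpha> + 1) / 2 * u\<^sup>2 + C * \<bar>u\<bar> ^ 3"
        by (rule C)
      also have "u\<^sup>2 = 4 * a\<^sup>2 + 4 * a * r\<^sup>2 + r ^ 4"
        unfolding u_def by algebra
      \<comment> \<open>Only \<open>4 * a\<^sup>2\<close> is kept from the square of u: the cross
        term is at most \<open>4 * r ^ 3\<close> and the last term at most
        \<open>r ^ 3\<close>.\<close>
      also have "\<alpha> * (\<alpha> + 1) / 2 * (4 * a\<^sup>2 + 4 * a * r\<^sup>2 + r ^ 4) \<le> \<alpha> * (\<alpha> + 1) / 2 * (4 * a\<^sup>2 + 5 * r ^ 3)"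
      proof (intro mult_left_mono)
        have "a * r\<^sup>2 \<le> r * r\<^sup>2" using ar by (intro mult_right_mono) auto
        also have "\<dots> = r ^ 3" by algebra
        finally show "4 * a\<^sup>2 + 4 * a * r\<^sup>2 + r ^ 4 \<le> 4 * a\<^sup>2 + 5 * r ^ 3" using rr by simp
      qed (use \<alpha> in simp)
      also have "C * \<bar>u\<bar> ^ 3 \<le> C * (9/4 * r) ^ 3"
        using C(1) ur by (intro mult_left_mono power_mono) auto
      finally have "(1 + u) powr (-\<alpha>) \<le> Q + (5 * (\<alpha> * (\<alpha> + 1) / 2) + (9/4)^3 * C) * r ^ 3"
        by (simp add: Q_def field_simps power_mult_distrib)
      also have "\<dots> \<le> Q + D * r powr p"
        using \<alpha> C(1) r3 r0 by (intro add_left_mono mult_mono) (auto simp: D_def)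
      finally have "(1 + u) powr (-\<alpha>) \<le> Q + D * r powr p" .
      hence "s powr (-\<alpha>) * (1 + u) powr (-\<alpha>) \<le> s powr (-\<alpha>) * (Q + D * r powr p)"
        using sa by (intro mult_left_mono)
      also have "\<dots> = s powr (-\<alpha>) * Q + s powr (-\<alpha>) * (D * r powr p)" by (simp add: algebra_simps)
      also have "s powr (-\<alpha>) * (D * r powr p) \<le> D * r powr p"
        using sa D0 by (intro mult_left_le_one_le) auto
      finally show ?thesis using s u1 by (simp add: powr_mult)
    next
      case False
      \<comment> \<open>No expansion here: the left side is at most 1, hence at most
        \<open>(4 * r) powr p\<close>. Since r is at most \<open>4 * r\<^sup>2\<close>, u is at most
        \<open>9 * r\<^sup>2\<close>, and \<open>r\<^sup>2\<close> is at most
        \<open>4 * r powr p\<close>; this bounds -Q.\<close>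
      hence r: "r > 1/4" by simp
      have "(s * (1 + u)) powr (-\<alpha>) \<le> 1"
        using powr_mono[of "-\<alpha>" 0 "s * (1 + u)"] u1 s \<alpha> by simp
      also have "1 \<le> (4 * r) powr p" using r p by (intro ge_one_powr_ge_zero) auto
      also have "\<dots> = 4 powr p * r powr p" using r by (simp add: powr_mult)
      also have "4 powr p \<le> (4::real) powr 3" using p by (intro powr_mono) auto
      finally have 1: "(s * (1 + u)) powr (-\<alpha>) \<le> 64 * r powr p" by (simp add: mult_right_mono)
      have "r\<^sup>2 = (4 * r) powr 2 / 16" using r by (simp add: powr_numeral power2_eq_square)
      also have "(4 * r) powr 2 \<le> (4 * r) powr p" using r p by (intro powr_mono) auto
      also have "\<dots> = 4 powr p * r powr p" using r by (simp add: powr_mult)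
      also have "4 powr p \<le> (4::real) powr 3" using p by (intro powr_mono) auto
      finally have 2: "r\<^sup>2 \<le> 4 * r powr p" by (simp add: mult_right_mono)
      have "r \<le> 4 * r\<^sup>2" using r by (simp add: power2_eq_square)
      hence "u \<le> 9 * r\<^sup>2" using ar unfolding u_def abs_le_iff by linarith
      also have "\<dots> \<le> 36 * r powr p" using 2 by simp
      finally have "\<alpha> * u \<le> \<alpha> * (36 * r powr p)" using \<alpha> by (intro mult_left_mono) auto
      moreover have "0 \<le> 2 * \<alpha> * (\<alpha> + 1) * a\<^sup>2" using \<alpha> by simp
      ultimately have 3: "- Q \<le> 36 * \<alpha> * r powr p" unfolding Q_def by linarith
      have "s powr (-\<alpha>) * (- Q) \<le> s powr (-\<alpha>) * (36 * \<alpha> * r powr p)"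
        using 3 sa by (intro mult_left_mono)
      also have "\<dots> \<le> 36 * \<alpha> * r powr p"
        using sa \<alpha> by (intro mult_left_le_one_le) auto
      finally have "0 \<le> s powr (-\<alpha>) * Q + 36 * \<alpha> * r powr p" by simp
      hence "(s * (1 + u)) powr (-\<alpha>) \<le> s powr (-\<alpha>) * Q + (64 + 36 * \<alpha>) * r powr p"
        using 1 by (simp add: algebra_simps)
      also have "\<dots> \<le> s powr (-\<alpha>) * Q + D * r powr p"
        using \<alpha> C(1) by (intro add_left_mono mult_right_mono) (auto simp: D_def)
      finally show ?thesis .
    qed
    have "Q = 1 - \<alpha> * (2 * (y \<bullet> h) + (norm h)\<^sup>2) / s + 2 * \<alpha> * (\<alpha> + 1) * (y \<bullet> h)\<^sup>2 / s\<^sup>2"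
      using s by (simp add: Q_def u_def r2 a_def field_simps power_divide)
    with main rp seq show "(K + (norm (y + h))\<^sup>2) powr (-\<alpha>) \<le>
         (K + (norm y)\<^sup>2) powr (-\<alpha>) *
           (1 - \<alpha> * (2 * (y \<bullet> h) + (norm h)\<^sup>2) / (K + (norm y)\<^sup>2)
              + 2 * \<alpha> * (\<alpha> + 1) * (y \<bullet> h)\<^sup>2 / (K + (norm y)\<^sup>2)\<^sup>2)
         + D * norm h powr p * (K + (norm y)\<^sup>2) powr (- p / 2)"
      by (simp add: s_def[symmetric] mult.assoc)
  qed
qed

lemma eventually_le_mult_powr:
  fixes a c e :: real
  assumes "c > 0" "e > 0"
  shows "eventually (\<lambda>K. a \<le> c * K powr e) at_top"
proof -
  define b where "b = max 0 (a / c)"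
  have "a \<le> c * K powr e" if "K \<ge> b powr (1 / e)" for K
  proof -
    have "a \<le> c * b" using assms by (simp add: b_def max_def field_simps)
    also have "b = (b powr (1 / e)) powr e" using assms by (simp add: powr_powr b_def)
    also have "\<dots> \<le> K powr e" using assms that by (intro powr_mono2) auto
    finally show ?thesis using assms by simp
  qed
  thus ?thesis by (rule eventually_at_top_linorderI)
qed

lemma norm_powr_le:
  fixes x :: "'b::real_normed_vector"
  assumes "q \<le> p" "q > 0"
  shows "norm x powr q \<le> 1 + norm x powr p"
proof (cases "norm x \<le> 1")
  case True
  hence "norm x powr q \<le> 1" using assms by (intro powr_le1) auto
  thus ?thesis by (simp add: add_increasing2)
next
  case False
  hence "norm x powr q \<le> norm x powr p" using assms by (intro powr_mono) auto
  thus ?thesis by simp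
qed

lemma integrable_lower_moments:
  fixes \<nu> :: "'b::euclidean_space measure"
  assumes "prob_space \<nu>" and [measurable_cong]: "sets \<nu> = sets borel"
    and p: "p \<ge> 2" and int: "integrable \<nu> (\<lambda>x. norm x powr p)"
  shows "integrable \<nu> (\<lambda>x. x)" "integrable \<nu> (\<lambda>x. (norm x)\<^sup>2)" "integrable \<nu> (\<lambda>x. (v \<bullet> x) * (w \<bullet> x))"
proof -
  interpret prob_space \<nu> by fact
  have int1: "integrable \<nu> (\<lambda>x. 1 + norm x powr p)" using int by simp
  show "integrable \<nu> (\<lambda>x. x)"
    using norm_powr_le[of 1 p] p by (intro Bochner_Integration.integrable_bound[OF int1]) auto
  show int2: "integrable \<nu> (\<lambda>x. (norm x)\<^sup>2)"
    using norm_powr_le[of 2 p] p by (intro Bochner_Integration.integrable_bound[OF int1]) auto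
  show "integrable \<nu> (\<lambda>x. (v \<bullet> x) * (w \<bullet> x))"
  proof (rule Bochner_Integration.integrable_bound)
    show "integrable \<nu> (\<lambda>x. (norm v * norm w) * (norm x)\<^sup>2)" using int2 by simp
    have "\<bar>v \<bullet> x\<bar> * \<bar>w \<bullet> x\<bar> \<le> (norm v * norm x) * (norm w * norm x)" for x
      by (intro mult_mono Cauchy_Schwarz_ineq2) auto
    thus "AE x in \<nu>. norm ((v \<bullet> x) * (w \<bullet> x)) \<le> norm ((norm v * norm w) * (norm x)\<^sup>2)"
      by (simp add: abs_mult power2_eq_square ac_simps)
  qed measurable
qed

text \<open>Integrate the pointwise expansion, with s = K + |y|^2. The first-order term vanishes
  because the mean is zero. The second-order terms contribute at most -\<alpha> (T - 2 (1 +
  \<alpha>) \<rho>) times \<open>s powr (-\<alpha> - 1)\<close>, where T is the trace of the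
  covariance, and the trace condition makes this negative. The remainder is of order
  \<open>s powr (- p / 2)\<close>, which is smaller because p/2 > 1 + \<alpha>. Since s \<ge> K for
  every y, a large K makes it negligible uniformly in y.\<close>

lemma lyapunov_drift:
  fixes \<nu> :: "'b::euclidean_space measure"
  assumes prob: "prob_space \<nu>" and sets[measurable_cong]: "sets \<nu> = sets borel"
    and p: "p \<le> 3" and int: "integrable \<nu> (\<lambda>x. norm x powr p)"
    and mean: "(\<integral>x. x \<partial>\<nu>) = 0"
    and \<rho>: "\<rho> \<ge> 0" "\<And>w. (\<integral>x. (w \<bullet> x)\<^sup>2 \<partial>\<nu>) \<le> \<rho> * (norm w)\<^sup>2"
    and \<alpha>: "\<alpha> > 0" "2 * \<alpha> < p - 2" "2 * (1 + \<alpha>) * \<rho> < (\<integral>x. (norm x)\<^sup>2 \<partial>\<nu>)"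
  obtains c where "c > 0"
    "eventually (\<lambda>K. \<forall>y. (\<integral>\<^sup>+h. ennreal ((K + (norm (y + h))\<^sup>2) powr (-\<alpha>)) \<partial>\<nu>)
        + ennreal (c * (K + (norm y)\<^sup>2) powr (-\<alpha> - 1)) \<le> ennreal ((K + (norm y)\<^sup>2) powr (-\<alpha>))) at_top"
proof -
  interpret prob_space \<nu> by fact
  have p2: "p \<ge> 2" using \<alpha> by simp
  note ints = integrable_lower_moments[OF prob sets p2 int]
  obtain C where C: "C \<ge> 0"
    "\<And>K (y::'b) h. K \<ge> 1 \<Longrightarrow> 
       (K + (norm (y + h))\<^sup>2) powr (-\<alpha>) \<le>
         (K + (norm y)\<^sup>2) powr (-\<alpha>) *
           (1 - \<alpha> * (2 * (y \<bullet> h) + (norm h)\<^sup>2) / (K + (norm y)\<^sup>2)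
              + 2 * \<alpha> * (\<alpha> + 1) * (y \<bullet> h)\<^sup>2 / (K + (norm y)\<^sup>2)\<^sup>2)
         + C * norm h powr p * (K + (norm y)\<^sup>2) powr (- p / 2)"
    using lyapunov_taylor[OF \<alpha>(1) p2 p] by blast
  define T where "T = (\<integral>x. (norm x)\<^sup>2 \<partial>\<nu>)"
  define m where "m = (\<integral>x. norm x powr p \<partial>\<nu>)"
  \<comment> \<open>Half of the second-order gain: the other half is reserved for absorbing the
    Taylor error.\<close>
  define c where "c = \<alpha> * (T - 2 * (1 + \<alpha>) * \<rho>) / 2"
  have c: "c > 0" using \<alpha> by (simp add: c_def T_def)
  have m: "m \<ge> 0" by (simp add: m_def)
  show thesis
  proof (rule that[OF c])
    have "eventually (\<lambda>K. C * m \<le> c * K powr (p / 2 - \<alpha> - 1)) at_top"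
      using \<alpha> c by (intro eventually_le_mult_powr) auto
    then show "eventually (\<lambda>K. \<forall>y. (\<integral>\<^sup>+h. ennreal ((K + (norm (y + h))\<^sup>2) powr (-\<alpha>)) \<partial>\<nu>)
        + ennreal (c * (K + (norm y)\<^sup>2) powr (-\<alpha> - 1)) \<le> ennreal ((K + (norm y)\<^sup>2) powr (-\<alpha>))) at_top"
      using eventually_ge_at_top[of 1]
    proof eventually_elim
      fix K :: real assume K: "C * m \<le> c * K powr (p / 2 - \<alpha> - 1)" "1 \<le> K"
      show "\<forall>y. (\<integral>\<^sup>+h. ennreal ((K + (norm (y + h))\<^sup>2) powr (-\<alpha>)) \<partial>\<nu>)
        + ennreal (c * (K + (norm y)\<^sup>2) powr (-\<alpha> - 1)) \<le> ennreal ((K + (norm y)\<^sup>2) powr (-\<alpha>))"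
      proof
        fix y :: 'b
        define s where "s = K + (norm y)\<^sup>2"
        have s: "s \<ge> 1" "s \<ge> K" using K by (auto simp: s_def add_increasing2)
        define f where "f h = (K + (norm (y + h))\<^sup>2) powr (-\<alpha>)" for h
        define R where "R h = s powr (-\<alpha>) * (1 - \<alpha> * (2 * (y \<bullet> h) + (norm h)\<^sup>2) / s
              + 2 * \<alpha> * (\<alpha> + 1) * (y \<bullet> h)\<^sup>2 / s\<^sup>2) + C * norm h powr p * s powr (- p / 2)" for h
        define Q where "Q = (\<integral>h. (y \<bullet> h)\<^sup>2 \<partial>\<nu>)"
        have intf: "integrable \<nu> f"
        proof (rule integrable_const_bound[where B = 1])
          have "f h \<le> 1" for h
            using powr_mono[of "-\<alpha>" 0 "K + (norm (y + h))\<^sup>2"] K \<alpha> by (simp add: f_def add_increasing2 split: if_splits)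
          thus "AE h in \<nu>. norm (f h) \<le> 1" by (simp add: f_def)
        qed (unfold f_def, measurable)
        have i1: "integrable \<nu> (\<lambda>h. y \<bullet> h)" using ints(1) by simp
        have i1': "(\<integral>h. y \<bullet> h \<partial>\<nu>) = 0" using ints(1) mean by simp
        have i2: "integrable \<nu> (\<lambda>h. (y \<bullet> h)\<^sup>2)" using ints(3)[of y y] by (simp add: power2_eq_square)
        note i3 = ints(2)
        have RR: "has_bochner_integral \<nu> R (s powr (-\<alpha>) * (1 - \<alpha> * (2 * 0 + T) / s
              + 2 * \<alpha> * (\<alpha> + 1) * Q / s\<^sup>2) + C * m * s powr (- p / 2))"
        proof -
          have h: "has_bochner_integral \<nu> (\<lambda>h. y \<bullet> h) 0" "has_bochner_integral \<nu> (\<lambda>h. (norm h)\<^sup>2) T"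
            "has_bochner_integral \<nu> (\<lambda>h. (y \<bullet> h)\<^sup>2) Q" "has_bochner_integral \<nu> (\<lambda>h. norm h powr p) m"
            "has_bochner_integral \<nu> (\<lambda>h. 1 :: real) 1"
            using i1 i1' i2 i3 int by (auto simp: has_bochner_integral_iff T_def Q_def m_def prob_space)
          show ?thesis unfolding R_def
            by (intro has_bochner_integral_add has_bochner_integral_diff has_bochner_integral_mult_left
                has_bochner_integral_mult_right has_bochner_integral_divide h)
        qed
        have "f h \<le> R h" for h
          unfolding f_def R_def s_def using K by (intro C(2))
        hence "(\<integral>h. f h \<partial>\<nu>) \<le> (\<integral>h. R h \<partial>\<nu>)"
          using intf RR by (intro integral_mono) (auto simp: has_bochner_integral_iff)
        also have "\<dots> = s powr (-\<alpha>) * (1 - \<alpha> * T / s + 2 * \<alpha> * (\<alpha> + 1) * Q / s\<^sup>2) + C * m * s powr (- p / 2)"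
          using RR by (simp add: has_bochner_integral_iff)
        also have "\<dots> \<le> s powr (-\<alpha>) * (1 - 2 * c / s) + c * s powr (-\<alpha> - 1)"
        proof (intro add_mono mult_left_mono)
          have "Q \<le> \<rho> * (norm y)\<^sup>2" unfolding Q_def by (rule \<rho>)
          also have "\<dots> \<le> \<rho> * s" using \<rho>(1) K by (intro mult_left_mono) (auto simp: s_def)
          finally have "Q / s \<le> \<rho>" using s by (simp add: field_simps)
          hence "2 * \<alpha> * (\<alpha> + 1) * (Q / s) \<le> 2 * \<alpha> * (\<alpha> + 1) * \<rho>" using \<alpha> by (intro mult_left_mono) auto
          hence "(2 * \<alpha> * (\<alpha> + 1) * (Q / s)) / s \<le> (2 * \<alpha> * (\<alpha> + 1) * \<rho>) / s"
            using s by (intro divide_right_mono) auto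
          moreover have "2 * c / s = \<alpha> * T / s - (2 * \<alpha> * (\<alpha> + 1) * \<rho>) / s"
            using s by (simp add: c_def field_simps)
          moreover have "2 * \<alpha> * (\<alpha> + 1) * Q / s\<^sup>2 = (2 * \<alpha> * (\<alpha> + 1) * (Q / s)) / s"
            by (simp add: power2_eq_square)
          ultimately show "1 - \<alpha> * T / s + 2 * \<alpha> * (\<alpha> + 1) * Q / s\<^sup>2 \<le> 1 - 2 * c / s" by linarith
        next
          \<comment> \<open>The exponent is positive and s \<ge> K, so the choice of K settles the
            error bound at every y.\<close>
          have "c * K powr (p / 2 - \<alpha> - 1) \<le> c * s powr (p / 2 - \<alpha> - 1)"
            using c s K \<alpha> by (intro mult_left_mono powr_mono2) auto
          hence "C * m \<le> c * s powr (p / 2 - \<alpha> - 1)" using K by simp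
          hence "C * m * s powr (- p / 2) \<le> c * s powr (p / 2 - \<alpha> - 1) * s powr (- p / 2)"
            by (intro mult_right_mono) auto
          also have "\<dots> = c * s powr (-\<alpha> - 1)"
            by (simp add: mult.assoc powr_add[symmetric])
          finally show "C * m * s powr (- p / 2) \<le> c * s powr (-\<alpha> - 1)" .
        qed simp
        also have "s powr (-\<alpha>) * (1 - 2 * c / s) = s powr (-\<alpha>) - 2 * c * s powr (-\<alpha> - 1)"
          using s by (simp add: powr_diff field_simps)
        finally have "(\<integral>h. f h \<partial>\<nu>) + c * s powr (-\<alpha> - 1) \<le> s powr (-\<alpha>)" by simp
        moreover have "(\<integral>\<^sup>+h. ennreal (f h) \<partial>\<nu>) = ennreal (\<integral>h. f h \<partial>\<nu>)"
          by (rule nn_integral_eq_integral[OF intf]) (simp add: f_def)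
        moreover have "(\<integral>h. f h \<partial>\<nu>) \<ge> 0" by (simp add: f_def)
        ultimately have "(\<integral>\<^sup>+h. ennreal (f h) \<partial>\<nu>) + ennreal (c * s powr (-\<alpha> - 1)) \<le> ennreal (s powr (-\<alpha>))"
          using c by (simp add: ennreal_plus[symmetric] del: ennreal_plus)
        thus "(\<integral>\<^sup>+h. ennreal ((K + (norm (y + h))\<^sup>2) powr (-\<alpha>)) \<partial>\<nu>)
          + ennreal (c * (K + (norm y)\<^sup>2) powr (-\<alpha> - 1)) \<le> ennreal ((K + (norm y)\<^sup>2) powr (-\<alpha>))"
          by (simp add: f_def s_def)
      qed
    qed
  qed
qed

section \<open>Walks with adapted rules\<close>

text \<open>Independence gives the product formula on rectangles, which identifies the joint law of
  Z and W as the product of their laws; Tonelli then allows W to be integrated out with Z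
  frozen.\<close>

lemma (in prob_space) nn_integral_indep_set:
  assumes indep: "indep_set \<A> \<B>"
    and [measurable]: "Z \<in> measurable M S" "W \<in> measurable M T" "f \<in> borel_measurable (S \<Otimes>\<^sub>M T)"
    and Z: "\<And>A. A \<in> sets S \<Longrightarrow> Z -` A \<inter> space M \<in> \<A>"
    and W: "\<And>B. B \<in> sets T \<Longrightarrow> W -` B \<inter> space M \<in> \<B>"
  shows "(\<integral>\<^sup>+\<omega>. f (Z \<omega>, W \<omega>) \<partial>M) = (\<integral>\<^sup>+\<omega>. (\<integral>\<^sup>+w. f (Z \<omega>, w) \<partial>distr M T W) \<partial>M)"
proof -
  interpret Z: prob_space "distr M S Z" by (rule prob_space_distr) measurable
  interpret W: prob_space "distr M T W" by (rule prob_space_distr) measurable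
  have eq: "distr M S Z \<Otimes>\<^sub>M distr M T W = distr M (S \<Otimes>\<^sub>M T) (\<lambda>\<omega>. (Z \<omega>, W \<omega>))"
  proof (rule pair_measure_eqI)
    fix A B assume "A \<in> sets (distr M S Z)" "B \<in> sets (distr M T W)"
    hence [measurable]: "A \<in> sets S" "B \<in> sets T" by auto
    have "prob ((Z -` A \<inter> space M) \<inter> (W -` B \<inter> space M))
        = prob (Z -` A \<inter> space M) * prob (W -` B \<inter> space M)"
      by (intro indep_setD[OF indep] Z W) auto
    moreover have "(Z -` A \<inter> space M) \<inter> (W -` B \<inter> space M) = (\<lambda>\<omega>. (Z \<omega>, W \<omega>)) -` (A \<times> B) \<inter> space M"
      by auto
    ultimately show "emeasure (distr M S Z) A * emeasure (distr M T W) B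
        = emeasure (distr M (S \<Otimes>\<^sub>M T) (\<lambda>\<omega>. (Z \<omega>, W \<omega>))) (A \<times> B)"
      by (simp add: emeasure_distr emeasure_eq_measure ennreal_mult)
  qed (auto intro: Z.sigma_finite_measure_axioms W.sigma_finite_measure_axioms)
  have "(\<integral>\<^sup>+\<omega>. f (Z \<omega>, W \<omega>) \<partial>M) = (\<integral>\<^sup>+q. f q \<partial>(distr M S Z \<Otimes>\<^sub>M distr M T W))"
    unfolding eq by (subst nn_integral_distr) auto
  also have "\<dots> = (\<integral>\<^sup>+z. (\<integral>\<^sup>+w. f (z, w) \<partial>distr M T W) \<partial>distr M S Z)"
    by (subst W.nn_integral_fst[symmetric]) auto
  also have "\<dots> = (\<integral>\<^sup>+\<omega>. (\<integral>\<^sup>+w. f (Z \<omega>, w) \<partial>distr M T W) \<partial>M)"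
    by (subst nn_integral_distr) auto
  finally show ?thesis .
qed

context generated_walk
begin

lemma measurable_F_M: "f \<in> measurable (F i) N \<Longrightarrow> f \<in> measurable M N"
  using F_subalgebra[of i] by (rule measurable_from_subalg)

lemma rule_range: "\<omega> \<in> space M \<Longrightarrow> l i \<omega> \<in> {1..k}"
  using measurable_space[OF rule_adapted[of i], of \<omega>] by (simp add: space_F)

lemma rule_pred: "Measurable.pred (F i) (\<lambda>\<omega>. l i \<omega> = j)"
  by (rule measurable_compose[OF rule_adapted]) simp

lemma measurable_F_Suc: "f \<in> measurable (F i) N \<Longrightarrow> f \<in> measurable (F (Suc i)) N"
  using sets_F_mono[of i "Suc i"] measurable_mono[of N N "F i" "F (Suc i)"] by (auto simp: space_F)

lemma X_adapted: "X i \<in> borel_measurable (F i)"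
proof (induction i)
  case 0
  show ?case by (subst measurable_cong[where g = "\<lambda>_. 0"]) (auto simp: X_0 space_F)
next
  case (Suc i)
  \<comment> \<open>The increment with random index is rewritten as a finite sum over the values of
    the rule, whose level sets belong to the past.\<close>
  have "(\<lambda>\<omega>. X i \<omega> + (\<Sum>j\<in>{1..k}. if l i \<omega> = j then \<xi> j (Suc i) \<omega> else 0)) \<in> borel_measurable (F (Suc i))"
  proof (intro borel_measurable_add borel_measurable_sum measurable_If)
    fix j assume "j \<in> {1..k}"
    thus "\<xi> j (Suc i) \<in> borel_measurable (F (Suc i))" using \<xi>_adapted[of j "Suc i"] by simp
    show "{\<omega> \<in> space (F (Suc i)). l i \<omega> = j} \<in> sets (F (Suc i))"
      using measurable_F_Suc[OF rule_pred] by (rule predE)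
  qed (use measurable_F_Suc[OF Suc] in auto)
  also have "?this \<longleftrightarrow> ?case"
    using rule_range X_step by (intro measurable_cong) (auto simp: sum.delta space_F)
  finally show ?case .
qed

lemma \<xi>_measurable: "j \<in> {1..k} \<Longrightarrow> \<xi> j (Suc i) \<in> borel_measurable M"
  using \<xi>_adapted[of j "Suc i"] by (auto intro: measurable_F_M)

text \<open>An integrated form of conditioning on \<open>F i\<close>: past data are frozen while the
  next increment of a fixed kind is averaged under its law.\<close>

lemma nn_integral_past_increment:
  assumes j: "j \<in> {1..k}"
    and Z: "Z \<in> measurable (F i) N"
    and f: "f \<in> borel_measurable (N \<Otimes>\<^sub>M borel)"
  shows "(\<integral>\<^sup>+\<omega>. f (Z \<omega>, \<xi> j (Suc i) \<omega>) \<partial>M) = (\<integral>\<^sup>+\<omega>. (\<integral>\<^sup>+h. f (Z \<omega>, h) \<partial>\<mu> j) \<partial>M)"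
proof -
  let ?V = "vimage_algebra (space M) (\<lambda>\<omega>. \<lambda>j\<in>{1..k}. \<xi> j (i + 1) \<omega>) (Pi\<^sub>M {1..k} (\<lambda>_. borel :: (real^'d) measure))"
  have "(\<lambda>\<omega>. \<lambda>j\<in>{1..k}. \<xi> j (i + 1) \<omega>) \<in> measurable ?V (Pi\<^sub>M {1..k} (\<lambda>_. borel))"
    by (rule measurable_vimage_algebra1) (auto simp: space_PiM)
  \<comment> \<open>Independence from the past is given for the joint vector of increments; a single
    kind inherits it as a coordinate of that vector.\<close>
  from measurable_compose[OF this measurable_component_singleton[OF j]]
  have "\<xi> j (Suc i) \<in> borel_measurable ?V" using j by simp
  hence "\<xi> j (Suc i) -` B \<inter> space M \<in> sets ?V" if "B \<in> sets borel" for B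
    using measurable_sets[of _ ?V borel B] that by simp
  moreover have "Z -` A \<inter> space M \<in> sets (F i)" if "A \<in> sets N" for A
    using measurable_sets[OF Z that] by (simp add: space_F)
  moreover have "distr M borel (\<xi> j (Suc i)) = \<mu> j" using \<xi>_law[OF j, of "Suc i"] by simp
  ultimately show ?thesis
    using nn_integral_indep_set[OF \<xi>_indep_past[of i] measurable_F_M[OF Z] \<xi>_measurable[OF j] f] by simp
qed

text \<open>The increment actually used depends on the rule, so independence is applied separately
  on the events \<open>l i \<omega> = j\<close>. These belong to \<open>F i\<close>, and on each of
  them the increment has law \<open>\<mu> j\<close> given the past. As the drift inequality holds
  for every law, the rule's choice does not matter.\<close>

lemma lyapunov_one_step:
  fixes \<phi> g :: "real^'d \<Rightarrow> ennreal"
  assumes [measurable]: "\<phi> \<in> borel_measurable borel" "g \<in> borel_measurable borel"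
    and drift: "\<And>j x. j \<in> {1..k} \<Longrightarrow> (\<integral>\<^sup>+h. \<phi> (x + h) \<partial>\<mu> j) + g x \<le> \<phi> x"
  shows "(\<integral>\<^sup>+\<omega>. \<phi> (X (Suc i) \<omega>) \<partial>M) + (\<integral>\<^sup>+\<omega>. g (X i \<omega>) \<partial>M) \<le> (\<integral>\<^sup>+\<omega>. \<phi> (X i \<omega>) \<partial>M)"
proof -
  define I :: "nat \<Rightarrow> 'a \<Rightarrow> ennreal" where "I j \<omega> = (if l i \<omega> = j then 1 else 0)" for j \<omega>
  have IF[measurable]: "I j \<in> borel_measurable (F i)" for j
    unfolding I_def by (intro measurable_If predE[OF rule_pred]) auto
  have [measurable]: "I j \<in> borel_measurable M" for j
    by (rule measurable_F_M[OF IF])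
  have [measurable]: "X i \<in> borel_measurable M" by (rule measurable_F_M[OF X_adapted])
  note \<xi>_measurable[measurable]
  have split: "f (l i \<omega>) = (\<Sum>j\<in>{1..k}. I j \<omega> * f j)" if "\<omega> \<in> space M" for f :: "nat \<Rightarrow> ennreal" and \<omega>
  proof -
    have "(\<Sum>j\<in>{1..k}. I j \<omega> * f j) = (\<Sum>j\<in>{1..k}. if l i \<omega> = j then f j else 0)"
      by (intro sum.cong) (auto simp: I_def)
    thus ?thesis using rule_range[OF that, of i] by simp
  qed
  have split': "(\<integral>\<^sup>+h. \<phi> (X i \<omega> + h) \<partial>\<mu> (l i \<omega>)) = (\<Sum>j\<in>{1..k}. I j \<omega> * (\<integral>\<^sup>+h. \<phi> (X i \<omega> + h) \<partial>\<mu> j))"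
    if "\<omega> \<in> space M" for \<omega>
    using split[OF that, of "\<lambda>j. \<integral>\<^sup>+h. \<phi> (X i \<omega> + h) \<partial>\<mu> j"] .
  have step: "(\<integral>\<^sup>+\<omega>. I j \<omega> * \<phi> (X i \<omega> + \<xi> j (Suc i) \<omega>) \<partial>M) = (\<integral>\<^sup>+\<omega>. I j \<omega> * (\<integral>\<^sup>+h. \<phi> (X i \<omega> + h) \<partial>\<mu> j) \<partial>M)"
    if j: "j \<in> {1..k}" for j
  proof -
    \<comment> \<open>The indicator of the rule's choice and the current position are frozen
      together as one past variable.\<close>
    have "(\<lambda>\<omega>. (I j \<omega>, X i \<omega>)) \<in> measurable (F i) (borel \<Otimes>\<^sub>M borel)"
      using X_adapted[of i] by measurable
    from nn_integral_past_increment[OF j this, of "\<lambda>q. fst (fst q) * \<phi> (snd (fst q) + snd q)"]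
    have "(\<integral>\<^sup>+\<omega>. I j \<omega> * \<phi> (X i \<omega> + \<xi> j (Suc i) \<omega>) \<partial>M) = 
      (\<integral>\<^sup>+\<omega>. (\<integral>\<^sup>+h. I j \<omega> * \<phi> (X i \<omega> + h) \<partial>\<mu> j) \<partial>M)"
      by simp
    also have "(\<lambda>\<omega>. (\<integral>\<^sup>+h. I j \<omega> * \<phi> (X i \<omega> + h) \<partial>\<mu> j)) = (\<lambda>\<omega>. I j \<omega> * (\<integral>\<^sup>+h. \<phi> (X i \<omega> + h) \<partial>\<mu> j))"
      using prob_\<mu>[OF j] by (intro ext nn_integral_cmult) (auto simp: borel_prob_measure_def cong: measurable_cong_sets)
    finally show ?thesis .
  qed
  have meas: "(\<lambda>\<omega>. \<integral>\<^sup>+h. \<phi> (X i \<omega> + h) \<partial>\<mu> j) \<in> borel_measurable M" if j: "j \<in> {1..k}" for j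
  proof -
    interpret \<mu>: prob_space "\<mu> j" using prob_\<mu>[OF j] by (simp add: borel_prob_measure_def)
    have [measurable_cong]: "sets (\<mu> j) = sets borel" using prob_\<mu>[OF j] by (simp add: borel_prob_measure_def)
    show ?thesis by measurable
  qed
  have "(\<integral>\<^sup>+\<omega>. \<phi> (X (Suc i) \<omega>) \<partial>M) = (\<integral>\<^sup>+\<omega>. (\<Sum>j\<in>{1..k}. I j \<omega> * \<phi> (X i \<omega> + \<xi> j (Suc i) \<omega>)) \<partial>M)"
    using X_step split by (intro nn_integral_cong) simp
  also have "\<dots> = (\<Sum>j\<in>{1..k}. \<integral>\<^sup>+\<omega>. I j \<omega> * \<phi> (X i \<omega> + \<xi> j (Suc i) \<omega>) \<partial>M)"
    by (intro nn_integral_sum) simp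
  also have "\<dots> = (\<Sum>j\<in>{1..k}. \<integral>\<^sup>+\<omega>. I j \<omega> * (\<integral>\<^sup>+h. \<phi> (X i \<omega> + h) \<partial>\<mu> j) \<partial>M)"
    by (intro sum.cong step) auto
  also have "\<dots> = (\<integral>\<^sup>+\<omega>. (\<Sum>j\<in>{1..k}. I j \<omega> * (\<integral>\<^sup>+h. \<phi> (X i \<omega> + h) \<partial>\<mu> j)) \<partial>M)"
    by (intro nn_integral_sum[symmetric] borel_measurable_times_ennreal meas) auto
  also have "\<dots> = (\<integral>\<^sup>+\<omega>. (\<integral>\<^sup>+h. \<phi> (X i \<omega> + h) \<partial>\<mu> (l i \<omega>)) \<partial>M)"
    by (intro nn_integral_cong split'[symmetric])
  finally have "(\<integral>\<^sup>+\<omega>. \<phi> (X (Suc i) \<omega>) \<partial>M) = (\<integral>\<^sup>+\<omega>. (\<integral>\<^sup>+h. \<phi> (X i \<omega> + h) \<partial>\<mu> (l i \<omega>)) \<partial>M)" .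
  moreover have "(\<lambda>\<omega>. \<integral>\<^sup>+h. \<phi> (X i \<omega> + h) \<partial>\<mu> (l i \<omega>)) \<in> borel_measurable M"
    by (subst measurable_cong[OF split']) (auto intro!: borel_measurable_sum borel_measurable_times_ennreal meas)
  ultimately have "(\<integral>\<^sup>+\<omega>. \<phi> (X (Suc i) \<omega>) \<partial>M) + (\<integral>\<^sup>+\<omega>. g (X i \<omega>) \<partial>M)
     = (\<integral>\<^sup>+\<omega>. (\<integral>\<^sup>+h. \<phi> (X i \<omega> + h) \<partial>\<mu> (l i \<omega>)) + g (X i \<omega>) \<partial>M)"
    by (simp add: nn_integral_add)
  also have "\<dots> \<le> (\<integral>\<^sup>+\<omega>. \<phi> (X i \<omega>) \<partial>M)"
    by (intro nn_integral_mono drift rule_range)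
  finally show ?thesis .
qed

text \<open>The one-step inequality telescopes. It is kept additive, with the term for
  \<open>X n\<close> on the left, because subtraction in \<open>ennreal\<close> does not cancel at
  infinity. That term is nonnegative and is dropped; the limit then moves inside the integral
  because all summands are nonnegative.\<close>

lemma lyapunov_occupation_bound:
  fixes \<phi> g :: "real^'d \<Rightarrow> ennreal"
  assumes [measurable]: "\<phi> \<in> borel_measurable borel" "g \<in> borel_measurable borel"
    and drift: "\<And>j x. j \<in> {1..k} \<Longrightarrow> (\<integral>\<^sup>+h. \<phi> (x + h) \<partial>\<mu> j) + g x \<le> \<phi> x"
  shows "(\<integral>\<^sup>+\<omega>. (\<Sum>i. g (X i \<omega>)) \<partial>M) \<le> \<phi> 0"
proof -
  have [measurable]: "X i \<in> borel_measurable M" for i by (rule measurable_F_M[OF X_adapted])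
  have "(\<integral>\<^sup>+\<omega>. \<phi> (X n \<omega>) \<partial>M) + (\<Sum>i<n. \<integral>\<^sup>+\<omega>. g (X i \<omega>) \<partial>M) \<le> \<phi> 0" for n
  proof (induction n)
    case 0
    have "(\<integral>\<^sup>+\<omega>. \<phi> (X 0 \<omega>) \<partial>M) = (\<integral>\<^sup>+\<omega>. \<phi> 0 \<partial>M)"
      by (intro nn_integral_cong) (simp add: X_0)
    thus ?case by (simp add: emeasure_space_1)
  next
    case (Suc n)
    have "(\<integral>\<^sup>+\<omega>. \<phi> (X (Suc n) \<omega>) \<partial>M) + (\<Sum>i<Suc n. \<integral>\<^sup>+\<omega>. g (X i \<omega>) \<partial>M)
      = ((\<integral>\<^sup>+\<omega>. \<phi> (X (Suc n) \<omega>) \<partial>M) + (\<integral>\<^sup>+\<omega>. g (X n \<omega>) \<partial>M)) + (\<Sum>i<n. \<integral>\<^sup>+\<omega>. g (X i \<omega>) \<partial>M)"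
      by (simp add: ac_simps)
    also have "\<dots> \<le> (\<integral>\<^sup>+\<omega>. \<phi> (X n \<omega>) \<partial>M) + (\<Sum>i<n. \<integral>\<^sup>+\<omega>. g (X i \<omega>) \<partial>M)"
      by (intro add_right_mono lyapunov_one_step[OF assms])
    also note Suc
    finally show ?case .
  qed
  hence "(\<Sum>i<n. \<integral>\<^sup>+\<omega>. g (X i \<omega>) \<partial>M) \<le> \<phi> 0" for n
    by (meson add_increasing order_trans order_refl zero_le)
  hence "(\<Sum>i. \<integral>\<^sup>+\<omega>. g (X i \<omega>) \<partial>M) \<le> \<phi> 0"
    by (auto simp: suminf_eq_SUP intro: SUP_least)
  thus ?thesis by (simp add: nn_integral_suminf)
qed

end

text \<open>The drift is applied at y = L x. The function g is bounded below by a positive constant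
  on each ball, since the norm of L x is at most B times the norm of x. Almost sure summability of g
  along the walk therefore leaves only finitely many visits to each ball.\<close>

lemma (in generated_walk) transient_if_drift:
  fixes L :: "real^'d \<Rightarrow> 'b::euclidean_space"
  assumes L: "linear L" and c: "c > 0" and K: "K > 0" and \<alpha>: "\<alpha> > 0"
    and drift: "\<And>j y. j \<in> {1..k} \<Longrightarrow>
      (\<integral>\<^sup>+h. ennreal ((K + (norm (y + L h))\<^sup>2) powr (-\<alpha>)) \<partial>\<mu> j)
        + ennreal (c * (K + (norm y)\<^sup>2) powr (-\<alpha> - 1)) \<le> ennreal ((K + (norm y)\<^sup>2) powr (-\<alpha>))"
  shows "transient M X"
proof -
  have [measurable]: "L \<in> borel_measurable borel"
    using L by (intro borel_measurable_continuous_onI linear_continuous_on) (simp add: linear_conv_bounded_linear)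
  have [measurable]: "X i \<in> borel_measurable M" for i by (rule measurable_F_M[OF X_adapted])
  define g where "g x = c * (K + (norm (L x))\<^sup>2) powr (-\<alpha> - 1)" for x
  have [measurable]: "g \<in> borel_measurable borel" unfolding g_def by measurable
  have g0: "g x \<ge> 0" for x using c by (simp add: g_def)
  obtain B where B: "B > 0" "\<And>x. norm (L x) \<le> B * norm x" using linear_bounded_pos[OF L] by blast
  have "(\<integral>\<^sup>+\<omega>. (\<Sum>i. ennreal (g (X i \<omega>))) \<partial>M) \<le> ennreal ((K + (norm (L 0))\<^sup>2) powr (-\<alpha>))"
    using drift
    by (intro lyapunov_occupation_bound[where \<phi> = "\<lambda>x. ennreal ((K + (norm (L x))\<^sup>2) powr (-\<alpha>))"])
      (auto simp: g_def linear_add[OF L])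
  hence "(\<integral>\<^sup>+\<omega>. (\<Sum>i. ennreal (g (X i \<omega>))) \<partial>M) \<noteq> \<infinity>"
    by (auto simp: top_unique)
  hence "AE \<omega> in M. (\<Sum>i. ennreal (g (X i \<omega>))) \<noteq> \<infinity>"
    by (intro nn_integral_PInf_AE) measurable
  hence "AE \<omega> in M. filterlim (\<lambda>t. norm (X t \<omega>)) at_top sequentially"
  proof eventually_elim
    case (elim \<omega>)
    hence "summable (\<lambda>i. g (X i \<omega>))" by (intro summable_suminf_not_top g0) simp
    hence lim: "(\<lambda>i. g (X i \<omega>)) \<longlonglongrightarrow> 0" by (rule summable_LIMSEQ_zero)
    show ?case
    proof (subst filterlim_at_top_ge[where c = 0], intro allI impI)
      fix r :: real assume r: "r \<ge> 0"
      have "c * (K + (B * r)\<^sup>2) powr (-\<alpha> - 1) > 0"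
        using c K by (simp add: add_pos_nonneg less_imp_neq[THEN not_sym])
      from order_tendstoD(2)[OF lim this]
      show "eventually (\<lambda>i. r \<le> norm (X i \<omega>)) sequentially"
      proof eventually_elim
        case (elim i)
        show ?case
        proof (rule ccontr)
          assume "\<not> r \<le> norm (X i \<omega>)"
          hence "norm (L (X i \<omega>)) \<le> B * r" using B(2)[of "X i \<omega>"] B(1)
            by (meson linorder_not_le less_imp_le mult_left_mono order_trans)
          hence "K + (norm (L (X i \<omega>)))\<^sup>2 \<le> K + (B * r)\<^sup>2"
            by (intro add_left_mono power_mono) auto
          hence "(K + (B * r)\<^sup>2) powr (-\<alpha> - 1) \<le> (K + (norm (L (X i \<omega>)))\<^sup>2) powr (-\<alpha> - 1)"
            using K \<alpha> by (intro powr_mono2') (auto intro: add_pos_nonneg)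
          thus False using elim c by (simp add: g_def)
        qed
      qed
    qed
  qed
  thus ?thesis by (simp add: transient_def)
qed

section \<open>Projected covariances\<close>

text \<open>If the form vanishes at v, then the inner product with v is almost surely 0, so the
  covariance matrix annihilates v and invertibility forces v = 0.\<close>

lemma cov_form_pos_def:
  fixes \<mu> :: "(real^'d) measure"
  assumes \<mu>: "borel_prob_measure \<mu>" "full_dimensional \<mu>" "has_moments \<mu> p" "p \<ge> 2"
  shows "pos_def_form (\<lambda>v w. \<integral>x. (v \<bullet> x) * (w \<bullet> x) \<partial>\<mu>)"
proof -
  have prob: "prob_space \<mu>" and sets: "sets \<mu> = sets borel" using \<mu> by (auto simp: borel_prob_measure_def)
  have int: "integrable \<mu> (\<lambda>x. (v \<bullet> x) * (w \<bullet> x))" for v w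
    using integrable_lower_moments(3)[OF prob sets] \<mu> by (auto simp: has_moments_def)
  have "v = 0" if 0: "(\<integral>x. (v \<bullet> x) * (v \<bullet> x) \<partial>\<mu>) = 0" for v
  proof -
    have AE: "AE x in \<mu>. v \<bullet> x = 0"
      using integral_nonneg_eq_0_iff_AE[OF int[of v v]] 0 by simp
    have "(cov_matrix \<mu> *v v) $ i = 0" for i
    proof -
      have "(cov_matrix \<mu> *v v) $ i = (\<Sum>j\<in>UNIV. \<integral>x. x $ i * x $ j * v $ j \<partial>\<mu>)"
        by (simp add: cov_matrix_def matrix_vector_mult_def)
      also have "\<dots> = (\<integral>x. (\<Sum>j\<in>UNIV. x $ i * x $ j * v $ j) \<partial>\<mu>)"
      proof (rule Bochner_Integration.integral_sum[symmetric])
        fix j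
        show "integrable \<mu> (\<lambda>x. x $ i * x $ j * v $ j)"
          using int[of "axis i 1" "axis j 1"] by (simp add: inner_axis' )
      qed
      also have "\<dots> = (\<integral>x. x $ i * (v \<bullet> x) \<partial>\<mu>)"
        by (simp add: inner_vec_def sum_distrib_left ac_simps)
      also have "\<dots> = 0"
        using AE by (intro integral_eq_zero_AE) auto
      finally show ?thesis .
    qed
    hence "cov_matrix \<mu> *v v = 0" by (simp add: vec_eq_iff)
    thus "v = 0"
      using \<mu>(2) matrix_left_invertible_ker[of "cov_matrix \<mu>"]
      by (auto simp: full_dimensional_def invertible_def)
  qed
  moreover have "bilinear (\<lambda>v w. \<integral>x. (v \<bullet> x) * (w \<bullet> x) \<partial>\<mu>)"
    unfolding bilinear_def
  proof (intro conjI allI linearI)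
    fix u v w :: "real^'d" and r :: real
    show "(\<integral>x. (u \<bullet> x) * ((v + w) \<bullet> x) \<partial>\<mu>) = (\<integral>x. (u \<bullet> x) * (v \<bullet> x) \<partial>\<mu>) + (\<integral>x. (u \<bullet> x) * (w \<bullet> x) \<partial>\<mu>)"
      "(\<integral>x. ((v + w) \<bullet> x) * (u \<bullet> x) \<partial>\<mu>) = (\<integral>x. (v \<bullet> x) * (u \<bullet> x) \<partial>\<mu>) + (\<integral>x. (w \<bullet> x) * (u \<bullet> x) \<partial>\<mu>)"
      using int by (simp_all add: inner_add algebra_simps)
    show "(\<integral>x. (u \<bullet> x) * ((r *\<^sub>R v) \<bullet> x) \<partial>\<mu>) = r *\<^sub>R (\<integral>x. (u \<bullet> x) * (v \<bullet> x) \<partial>\<mu>)"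
      "(\<integral>x. ((r *\<^sub>R v) \<bullet> x) * (u \<bullet> x) \<partial>\<mu>) = r *\<^sub>R (\<integral>x. (v \<bullet> x) * (u \<bullet> x) \<partial>\<mu>)"
      by (simp_all add: mult.left_commute[of _ r] mult.assoc)
  qed
  moreover have "(\<integral>x. (v \<bullet> x) * (v \<bullet> x) \<partial>\<mu>) \<ge> 0" for v by simp
  ultimately show ?thesis
    by (auto simp: pos_def_form_def mult.commute less_le)
qed

text \<open>Supplies the hypotheses of the drift estimate for the projected law. Orthogonality
  removes the off-diagonal terms of its covariance form, so a bound on the diagonal entries bounds
  the whole form and their sum is the second moment of the norm.\<close>

lemma projection_moments:
  fixes \<mu> :: "(real^'d) measure" and v :: "3 \<Rightarrow> real^'d" and \<rho> :: real
  defines "L \<equiv> (\<lambda>x. (\<chi> i. v i \<bullet> x) :: real^3)"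
  defines "\<nu> \<equiv> distr \<mu> borel L"
  assumes \<mu>: "borel_prob_measure \<mu>" "zero_mean \<mu>" "has_moments \<mu> p" "p \<ge> 2"
    and orth: "\<And>i j. i \<noteq> j \<Longrightarrow> (\<integral>x. (v i \<bullet> x) * (v j \<bullet> x) \<partial>\<mu>) = 0"
    and le: "\<And>i. (\<integral>x. (v i \<bullet> x) * (v i \<bullet> x) \<partial>\<mu>) \<le> \<rho>"
  shows "prob_space \<nu>" "sets \<nu> = sets borel" "integrable \<nu> (\<lambda>x. norm x powr p)" "(\<integral>x. x \<partial>\<nu>) = 0"
    "\<rho> \<ge> 0" "(\<integral>x. (w \<bullet> x)\<^sup>2 \<partial>\<nu>) \<le> \<rho> * (norm w)\<^sup>2"
    "(\<integral>x. (norm x)\<^sup>2 \<partial>\<nu>) = (\<Sum>i\<in>UNIV. \<integral>x. (v i \<bullet> x) * (v i \<bullet> x) \<partial>\<mu>)"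
proof -
  have prob: "prob_space \<mu>" and sets[measurable_cong]: "sets \<mu> = sets borel"
    using \<mu> by (auto simp: borel_prob_measure_def)
  have int: "integrable \<mu> (\<lambda>x. (a \<bullet> x) * (b \<bullet> x))" for a b
    using integrable_lower_moments(3)[OF prob sets] \<mu> by (auto simp: has_moments_def)
  have lin: "linear L" by (rule linearI) (auto simp: L_def vec_eq_iff inner_add)
  hence bl: "bounded_linear L" by (simp add: linear_conv_bounded_linear)
  have "L \<in> borel_measurable borel"
    by (intro borel_measurable_continuous_onI linear_continuous_on bl)
  hence [measurable]: "L \<in> measurable \<mu> borel" by (simp cong: measurable_cong_sets add: sets)
  show "prob_space \<nu>" unfolding \<nu>_def by (rule prob_space.prob_space_distr[OF prob]) measurable
  show "sets \<nu> = sets borel" by (simp add: \<nu>_def)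
  obtain B where B: "B > 0" "\<And>x. norm (L x) \<le> B * norm x" using linear_bounded_pos[OF lin] by blast
  have "integrable \<mu> (\<lambda>x. norm (L x) powr p)"
  proof (rule Bochner_Integration.integrable_bound)
    show "integrable \<mu> (\<lambda>x. B powr p * norm x powr p)" using \<mu> by (simp add: has_moments_def)
    have "norm (L x) powr p \<le> (B * norm x) powr p" for x
      using B \<mu>(4) by (intro powr_mono2) auto
    thus "AE x in \<mu>. norm (norm (L x) powr p) \<le> norm (B powr p * norm x powr p)"
      using B(1) by (simp add: powr_mult)
  qed measurable
  thus "integrable \<nu> (\<lambda>x. norm x powr p)"
    unfolding \<nu>_def by (subst integrable_distr_eq) auto
  have "(\<integral>x. x \<partial>\<nu>) = (\<integral>x. L x \<partial>\<mu>)" unfolding \<nu>_def by (subst integral_distr) auto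
  also have "\<dots> = L (\<integral>x. x \<partial>\<mu>)"
    using \<mu>(2) by (intro integral_bounded_linear[OF bl]) (simp add: zero_mean_def)
  also have "\<dots> = 0" using \<mu>(2) by (simp add: zero_mean_def linear_0[OF lin])
  finally show "(\<integral>x. x \<partial>\<nu>) = 0" .
  have "0 \<le> (\<integral>x. (v 1 \<bullet> x) * (v 1 \<bullet> x) \<partial>\<mu>)" by simp
  with le[of 1] show "\<rho> \<ge> 0" by linarith
  have "(\<integral>x. (w \<bullet> x)\<^sup>2 \<partial>\<nu>) = (\<integral>x. (w \<bullet> L x)\<^sup>2 \<partial>\<mu>)" unfolding \<nu>_def by (subst integral_distr) auto
  also have "\<dots> = (\<integral>x. (\<Sum>i\<in>UNIV. \<Sum>j\<in>UNIV. w $ i * w $ j * ((v i \<bullet> x) * (v j \<bullet> x))) \<partial>\<mu>)"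
    by (simp add: inner_vec_def[of w] L_def power2_eq_square sum_product ac_simps)
  also have "\<dots> = (\<Sum>i\<in>UNIV. \<Sum>j\<in>UNIV. w $ i * w $ j * (\<integral>x. (v i \<bullet> x) * (v j \<bullet> x) \<partial>\<mu>))"
    using int by (simp add: Bochner_Integration.integral_sum)
  also have "\<dots> = (\<Sum>i\<in>UNIV. \<Sum>j\<in>UNIV. if j = i then (w $ i)\<^sup>2 * (\<integral>x. (v i \<bullet> x) * (v i \<bullet> x) \<partial>\<mu>) else 0)"
    using orth by (intro sum.cong) (auto simp: power2_eq_square)
  also have "\<dots> \<le> (\<Sum>i\<in>UNIV. (w $ i)\<^sup>2 * \<rho>)"
    using le by (simp add: sum_mono mult_left_mono)
  also have "\<dots> = \<rho> * (norm w)\<^sup>2"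
    unfolding power2_norm_eq_inner by (simp add: inner_vec_def power2_eq_square sum_distrib_left mult.commute)
  finally show "(\<integral>x. (w \<bullet> x)\<^sup>2 \<partial>\<nu>) \<le> \<rho> * (norm w)\<^sup>2" .
  have "(\<integral>x. (norm x)\<^sup>2 \<partial>\<nu>) = (\<integral>x. (norm (L x))\<^sup>2 \<partial>\<mu>)" unfolding \<nu>_def by (subst integral_distr) auto
  also have "(\<lambda>x. (norm (L x))\<^sup>2) = (\<lambda>x. \<Sum>i\<in>UNIV. (v i \<bullet> x) * (v i \<bullet> x))"
    by (simp add: fun_eq_iff L_def power2_norm_eq_inner inner_vec_def[of "\<chi> i. v i \<bullet> _"])
  also have "(\<integral>x. (\<Sum>i\<in>UNIV. (v i \<bullet> x) * (v i \<bullet> x)) \<partial>\<mu>) = (\<Sum>i\<in>UNIV. \<integral>x. (v i \<bullet> x) * (v i \<bullet> x) \<partial>\<mu>)"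
    using int by (simp add: Bochner_Integration.integral_sum)
  finally show "(\<integral>x. (norm x)\<^sup>2 \<partial>\<nu>) = (\<Sum>i\<in>UNIV. \<integral>x. (v i \<bullet> x) * (v i \<bullet> x) \<partial>\<mu>)" .
qed

section \<open>Choice of the projection, the exponent and the shift, and conclusion\<close>

theorem theorem1p2:
  fixes M :: "'a measure"
    and F :: "nat \<Rightarrow> 'a measure"
    and \<mu> :: "nat \<Rightarrow> (real ^ 'd) measure"
    and \<xi> :: "nat \<Rightarrow> nat \<Rightarrow> 'a \<Rightarrow> real ^ 'd"
    and l :: "nat \<Rightarrow> 'a \<Rightarrow> nat"
    and X :: "nat \<Rightarrow> 'a \<Rightarrow> real ^ 'd"
    and \<beta> :: real
  assumes "CARD('d) \<ge> 3"
    and "\<beta> > 0"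
    and "\<And>j. j \<in> {1, 2} \<Longrightarrow> borel_prob_measure (\<mu> j)"
    and "\<And>j. j \<in> {1, 2} \<Longrightarrow> full_dimensional (\<mu> j)"
    and "\<And>j. j \<in> {1, 2} \<Longrightarrow> zero_mean (\<mu> j)"
    and "\<And>j. j \<in> {1, 2} \<Longrightarrow> has_moments (\<mu> j) (2 + \<beta>)"
    and "generated_walk M F 2 \<mu> \<xi> l X"
  shows "transient M X"
proof -
  interpret generated_walk M F 2 \<mu> \<xi> l X by fact
  \<comment> \<open>The cap at 3 matches the third-order Taylor remainder; lower moments follow from
    the given ones.\<close>
  define p where "p = 2 + min \<beta> 1"
  have p: "p > 2" "p \<le> 3" "p \<le> 2 + \<beta>" using assms(2) by (auto simp: p_def)
  have moments: "has_moments (\<mu> j) p" if j: "j \<in> {1, 2}" for j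
  proof -
    interpret \<mu>: prob_space "\<mu> j" using assms(3)[OF j] by (simp add: borel_prob_measure_def)
    have [measurable_cong]: "sets (\<mu> j) = sets borel" using assms(3)[OF j] by (simp add: borel_prob_measure_def)
    have "integrable (\<mu> j) (\<lambda>x. 1 + norm x powr (2 + \<beta>))"
      using assms(6)[OF j] by (simp add: has_moments_def)
    thus ?thesis unfolding has_moments_def
      by (rule Bochner_Integration.integrable_bound) (use norm_powr_le[of p "2 + \<beta>"] p in auto)
  qed
  define Q where "Q j = (\<lambda>v w. \<integral>x. (v \<bullet> x) * (w \<bullet> x) \<partial>\<mu> j)" for j
  have "pos_def_form (Q j)" if j: "j \<in> {1, 2}" for j
    unfolding Q_def using assms(3,4)[OF j] moments[OF j] p by (intro cov_form_pos_def[where p = p]) auto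
  hence Q12: "pos_def_form (Q 1)" "pos_def_form (Q 2)" by auto
  have dim: "DIM(real^'d) \<ge> 3" using assms(1) by simp
  obtain v :: "3 \<Rightarrow> real^'d" and \<rho>1 \<rho>2 where
    v1: "\<And>i j. i \<noteq> j \<Longrightarrow> Q 1 (v i) (v j) = 0" "\<And>i. Q 1 (v i) (v i) \<le> \<rho>1" "2 * \<rho>1 < (\<Sum>i\<in>UNIV. Q 1 (v i) (v i))" and
    v2: "\<And>i j. i \<noteq> j \<Longrightarrow> Q 2 (v i) (v j) = 0" "\<And>i. Q 2 (v i) (v i) \<le> \<rho>2" "2 * \<rho>2 < (\<Sum>i\<in>UNIV. Q 2 (v i) (v i))"
    by (rule simultaneous_trace_condition[OF Q12 dim], rule that)
  define \<rho> where "\<rho> j = (if j = 1 then \<rho>1 else \<rho>2)" for j :: nat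
  have v: "\<And>i k. i \<noteq> k \<Longrightarrow> Q j (v i) (v k) = 0" "\<And>i. Q j (v i) (v i) \<le> \<rho> j"
    "2 * \<rho> j < (\<Sum>i\<in>UNIV. Q j (v i) (v i))" if "j \<in> {1, 2}" for j
    using that v1 v2 by (auto simp: \<rho>_def)
  define L where "L = (\<lambda>x. (\<chi> i. v i \<bullet> x) :: real^3)"
  have lin: "linear L" by (rule linearI) (auto simp: L_def vec_eq_iff inner_add)
  define \<nu> where "\<nu> j = distr (\<mu> j) borel L" for j
  have push: "prob_space (\<nu> j)" "sets (\<nu> j) = sets borel" "integrable (\<nu> j) (\<lambda>x. norm x powr p)"
    "(\<integral>x. x \<partial>\<nu> j) = 0" "\<rho> j \<ge> 0" "\<And>w. (\<integral>x. (w \<bullet> x)\<^sup>2 \<partial>\<nu> j) \<le> \<rho> j * (norm w)\<^sup>2"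
    "(\<integral>x. (norm x)\<^sup>2 \<partial>\<nu> j) = (\<Sum>i\<in>UNIV. Q j (v i) (v i))" if j: "j \<in> {1, 2}" for j
    unfolding \<nu>_def L_def Q_def
    by (rule projection_moments[OF assms(3)[OF j] assms(5)[OF j] moments[OF j] less_imp_le[OF p(1)]];
        rule v(1,2)[OF j, unfolded Q_def]; assumption)+
  \<comment> \<open>The trace condition is strict, so it survives the factor 1 + \<alpha> for all
    small positive \<alpha>, simultaneously for both laws.\<close>
  have "eventually (\<lambda>\<alpha>. 2 * (1 + \<alpha>) * \<rho> j < (\<Sum>i\<in>UNIV. Q j (v i) (v i))) (at_right 0)"
    if "j \<in> {1, 2}" for j
  proof -
    have "((\<lambda>\<alpha>. 2 * (1 + \<alpha>) * \<rho> j) \<longlongrightarrow> 2 * (1 + 0) * \<rho> j) (at_right 0)"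
      by (intro tendsto_intros)
    thus ?thesis using v(3)[OF that] by (intro order_tendstoD) auto
  qed
  hence "eventually (\<lambda>\<alpha>. \<forall>j\<in>{1, 2}. 2 * (1 + \<alpha>) * \<rho> j < (\<Sum>i\<in>UNIV. Q j (v i) (v i))) (at_right 0)"
    by (intro eventually_ball_finite) auto
  moreover have "eventually (\<lambda>\<alpha>. \<alpha> \<in> {0<..<(p - 2) / 2}) (at_right 0)"
    using p by (intro eventually_at_right_real) auto
  ultimately have "\<exists>\<alpha>. \<alpha> \<in> {0<..<(p - 2) / 2} \<and>
      (\<forall>j\<in>{1, 2}. 2 * (1 + \<alpha>) * \<rho> j < (\<Sum>i\<in>UNIV. Q j (v i) (v i)))"
    by (intro eventually_happens'[OF trivial_limit_at_right_real] eventually_conj)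
  then obtain \<alpha> where "\<alpha> \<in> {0<..<(p - 2) / 2}" and
    \<alpha>3: "\<And>j. j \<in> {1, 2} \<Longrightarrow> 2 * (1 + \<alpha>) * \<rho> j < (\<Sum>i\<in>UNIV. Q j (v i) (v i))"
    by blast
  hence \<alpha>: "\<alpha> > 0" "2 * \<alpha> < p - 2" by auto
  define drift where "drift K c j \<longleftrightarrow> (\<forall>y. (\<integral>\<^sup>+h. ennreal ((K + (norm (y + h))\<^sup>2) powr (-\<alpha>)) \<partial>\<nu> j)
        + ennreal (c * (K + (norm y)\<^sup>2) powr (-\<alpha> - 1)) \<le> ennreal ((K + (norm y)\<^sup>2) powr (-\<alpha>)))" for K c j
  have "\<forall>j\<in>{1, 2}. \<exists>c. c > 0 \<and> eventually (\<lambda>K. drift K c j) at_top"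
  proof
    fix j :: nat assume j: "j \<in> {1, 2}"
    have lt: "2 * (1 + \<alpha>) * \<rho> j < (\<integral>x. (norm x)\<^sup>2 \<partial>\<nu> j)"
      using \<alpha>3[OF j] push(7)[OF j] by simp
    show "\<exists>c. c > 0 \<and> eventually (\<lambda>K. drift K c j) at_top"
      unfolding drift_def
      by (rule lyapunov_drift[OF push(1,2)[OF j] p(2) push(3-6)[OF j] \<alpha>(1,2) lt]) blast
  qed
  from bchoice[OF this] obtain c where c: "\<And>j. j \<in> {1, 2} \<Longrightarrow> c j > 0"
    "\<And>j. j \<in> {1, 2} \<Longrightarrow> eventually (\<lambda>K. drift K (c j) j) at_top" by blast
  \<comment> \<open>Each drift inequality holds for all large K, so one shift, and hence one
    Lyapunov function, serves both laws.\<close>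
  have "\<exists>K. K > 0 \<and> (\<forall>j\<in>{1, 2}. drift K (c j) j)"
    using c(2)
    by (intro eventually_happens'[OF trivial_limit_at_top_linorder] eventually_conj
        eventually_ball_finite eventually_gt_at_top) auto
  then obtain K where K: "K > 0" "\<And>j. j \<in> {1, 2} \<Longrightarrow> drift K (c j) j" by blast
  show ?thesis
  proof (rule transient_if_drift[OF lin _ K(1) \<alpha>(1)])
    \<comment> \<open>Lowering the gain constant only weakens the drift inequality, so the smaller
      of the two is valid for both laws.\<close>
    show "min (c 1) (c 2) > 0" using c(1) by simp
    fix j y assume "j \<in> {1..2::nat}"
    hence j: "j \<in> {1, 2}" by auto
    have [measurable_cong]: "sets (\<mu> j) = sets borel" using assms(3)[OF j] by (simp add: borel_prob_measure_def)
    have "L \<in> borel_measurable borel"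
      using lin by (intro borel_measurable_continuous_onI linear_continuous_on) (simp add: linear_conv_bounded_linear)
    hence [measurable]: "L \<in> measurable (\<mu> j) borel" by measurable
    have "(\<integral>\<^sup>+h. ennreal ((K + (norm (y + L h))\<^sup>2) powr (-\<alpha>)) \<partial>\<mu> j)
      = (\<integral>\<^sup>+h. ennreal ((K + (norm (y + h))\<^sup>2) powr (-\<alpha>)) \<partial>\<nu> j)"
      unfolding \<nu>_def by (subst nn_integral_distr) auto
    moreover have "ennreal (min (c 1) (c 2) * (K + (norm y)\<^sup>2) powr (-\<alpha> - 1))
        \<le> ennreal (c j * (K + (norm y)\<^sup>2) powr (-\<alpha> - 1))"
      using j by (intro ennreal_leI mult_right_mono) auto
    ultimately show "(\<integral>\<^sup>+h. ennreal ((K + (norm (y + L h))\<^sup>2) powr (-\<alpha>)) \<partial>\<mu> j)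
        + ennreal (min (c 1) (c 2) * (K + (norm y)\<^sup>2) powr (-\<alpha> - 1)) \<le> ennreal ((K + (norm y)\<^sup>2) powr (-\<alpha>))"
      using K(2)[OF j, unfolded drift_def, rule_format, of y] by (auto intro: order_trans[OF add_left_mono])
  qed
qed

end
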